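(* Let $n_0,k_0,d,\delta$ be nonnegative integers with $n_0\ge k_0$, and define $$C_i=\binom{n_0+id}{k_0+i\delta},\qquad i=0,1,2,\ldots.$$ Then: (i) if $d=\delta>0$ or $\delta=0$, the sequence $\{C_i\}_{i\ge0}$ is increasing, convex and log-concave; (ii) if $d<\delta$, the sequence $\{C_i\}_{i\ge0}$ is log-concave and therefore unimodal; (iii) if $d>\delta>0$, the sequence $\{C_i\}_{i\ge0}$ is increasing, convex, and asymptotically log-convex, i.e., there exists a nonnegative integer $m$ such that $C_m,C_{m+1},C_{m+2},\ldots$ is log-convex.
   Context: Binomial coefficients follow the convention $\binom{n}{k}=0$ unless $0\le k\le n$. For a sequence $a_0,a_1,a_2,\ldots$ of nonnegative numbers: it is increasing if $a_i\le a_{i+1}$ for all $i$; unimodal if $a_0\le a_1\le\cdots\le a_{m-1}\le a_m\ge a_{m+1}\ge\cdots$ for some $m$; convex if $a_{i-1}+a_{i+1}\ge 2a_i$ for all $i\ge1$; log-concave if $a_{i-1}a_{i+1}\le a_i^2$ for all $i\ge1$; log-convex if $a_{i-1}a_{i+1}\ge a_i^2$ for all $i\ge1$ (for a sequence starting at index $m$, the same conditions are required for all interior indices). *)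

theory Defs
  imports Complex_Main
begin

definition unimodal_seq :: "(nat \<Rightarrow> 'a::linordered_semidom) \<Rightarrow> bool" where
  "unimodal_seq a \<longleftrightarrow> (\<exists>m. (\<forall>i<m. a i \<le> a (i + 1)) \<and> (\<forall>i\<ge>m. a i \<ge> a (i + 1)))"

definition convex_seq :: "(nat \<Rightarrow> 'a::linordered_semidom) \<Rightarrow> bool" where
  "convex_seq a \<longleftrightarrow> (\<forall>i\<ge>1. a (i - 1) + a (i + 1) \<ge> 2 * a i)"

definition log_concave_seq :: "(nat \<Rightarrow> 'a::linordered_semidom) \<Rightarrow> bool" where
  "log_concave_seq a \<longleftrightarrow> (\<forall>i\<ge>1. a (i - 1) * a (i + 1) \<le> (a i)\<^sup>2)"

definition log_convex_seq :: "(nat \<Rightarrow> 'a::linordered_semidom) \<Rightarrow> bool" where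
  "log_convex_seq a \<longleftrightarrow> (\<forall>i\<ge>1. a (i - 1) * a (i + 1) \<ge> (a i)\<^sup>2)"

definition asymp_log_convex_seq :: "(nat \<Rightarrow> 'a::linordered_semidom) \<Rightarrow> bool" where
  "asymp_log_convex_seq a \<longleftrightarrow> (\<exists>m. log_convex_seq (\<lambda>i. a (m + i)))"

end

theory Submission
  imports Defs
begin

text \<open>
  Write \<open>B x y\<close> for the number \<open>(x + y choose x)\<close> of lattice paths to the point \<open>(x, y)\<close>.
  If \<open>\<delta> \<le> d\<close>, the indices of \<open>C\<close> run along a ray \<open>(x, y) + i (\<delta>, e)\<close> with \<open>e = d - \<delta> \<ge> 0\<close>.
  By Pascal's rule a unit step changes \<open>B\<close> by another value of \<open>B\<close>, and \<open>B\<close> is monotone in both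
  arguments; hence the increments of \<open>B\<close> are monotone too, which is convexity.
  Log-concavity comes from comparing consecutive quotients factor by factor.

  For \<open>d > \<delta> > 0\<close> the logarithm of \<open>C (i + 1) / C i\<close> extends to
  \<open>g t = (\<Sum>j=1..d. ln (n + j + d t)) - (\<Sum>j=1..\<delta>. ln (k + j + \<delta> t)) - (\<Sum>j=1..e. ln (n - k + j + e t))\<close>.
  In \<open>g'\<close> the terms of order \<open>1/t\<close> cancel, and \<open>t\<^sup>2 g' t\<close> tends to
  \<open>-(n + (d + 1)/2) + (k + (\<delta> + 1)/2) + (n - k + (e + 1)/2) = 1/2\<close>, so \<open>g\<close> is eventually increasing.
\<close>

section \<open>Lattice path counts: Pascal's rule and monotone increments\<close>

definition lattice_paths :: "nat \<Rightarrow> nat \<Rightarrow> nat" where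
  "lattice_paths x y = (x + y) choose x"

lemma lattice_paths_0 [simp]: "lattice_paths 0 y = 1" "lattice_paths x 0 = 1"
  by (simp_all add: lattice_paths_def)

lemma lattice_paths_Suc_Suc:
  "lattice_paths (Suc x) (Suc y) = lattice_paths x (Suc y) + lattice_paths (Suc x) y"
  by (simp add: lattice_paths_def)

lemma lattice_paths_commute: "lattice_paths x y = lattice_paths y x"
  using binomial_symmetric[of x "x + y"] by (simp add: lattice_paths_def add.commute)

lemma real_lattice_paths: "real (lattice_paths x y) = fact (x + y) / (fact x * fact y)"
  using binomial_fact[of x "x + y", where 'a = real] by (simp add: lattice_paths_def)

lemma lattice_paths_le_Suc: "lattice_paths x y \<le> lattice_paths (Suc x) y"
  by (cases y) (simp_all add: lattice_paths_Suc_Suc)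

lemma lattice_paths_mono:
  assumes "x \<le> x'" "y \<le> y'"
  shows "lattice_paths x y \<le> lattice_paths x' y'"
proof -
  have mono: "lattice_paths u w \<le> lattice_paths v w" if "u \<le> v" for u v w
    using that by (rule lift_Suc_mono_le[of "\<lambda>u. lattice_paths u w", OF lattice_paths_le_Suc])
  show ?thesis
    using mono[OF assms(1), of y] mono[OF assms(2), of x'] lattice_paths_commute by (metis le_trans)
qed

text \<open>By Pascal's rule, a unit step in \<open>x\<close> adds the count at
  \<open>(x + 1, y - 1)\<close>, or nothing when \<open>y = 0\<close>, and counts are monotone in
  both arguments. The terms are arranged so that no truncated subtraction occurs.\<close>

lemma lattice_paths_increment_mono_Suc:
  "lattice_paths (x + p) (y + q) + lattice_paths (Suc x) y
     \<le> lattice_paths (Suc x + p) (y + q) + lattice_paths x y"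
proof (cases y)
  case 0
  then show ?thesis
    using lattice_paths_le_Suc[of "x + p" q] by simp
next
  case (Suc y')
  have "lattice_paths (Suc x) y' \<le> lattice_paths (Suc (x + p)) (y' + q)"
    by (rule lattice_paths_mono) auto
  then show ?thesis
    by (simp add: Suc lattice_paths_Suc_Suc)
qed

text \<open>Unit steps in the first coordinate are iterated; exchanging the coordinates by symmetry
  then moves the second one.\<close>

lemma lattice_paths_increment_mono:
  assumes "x \<le> x'" "y \<le> y'"
  shows "int (lattice_paths (x + p) (y + q)) - int (lattice_paths x y)
           \<le> int (lattice_paths (x' + p) (y' + q)) - int (lattice_paths x' y')"
proof -
  have mono: "int (lattice_paths (u + r) (w + s)) - int (lattice_paths u w)
      \<le> int (lattice_paths (v + r) (w + s)) - int (lattice_paths v w)" if "u \<le> v" for u v w r s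
  proof (rule lift_Suc_mono_le[of "\<lambda>u. int (lattice_paths (u + r) (w + s)) - int (lattice_paths u w)", OF _ that])
    show "int (lattice_paths (n + r) (w + s)) - int (lattice_paths n w)
        \<le> int (lattice_paths (Suc n + r) (w + s)) - int (lattice_paths (Suc n) w)" for n
      using lattice_paths_increment_mono_Suc[of n r w s] by linarith
  qed
  show ?thesis
    using mono[OF assms(1), of p y q] mono[OF assms(2), of q x' p]
    by (simp add: lattice_paths_commute[of "x' + p"] lattice_paths_commute[of x'])
qed

section \<open>Monotonicity and convexity along a ray\<close>

lemma incseq_lattice_paths: "incseq (\<lambda>i. lattice_paths (x + i * p) (y + i * q))"
  by (intro monoI lattice_paths_mono) (simp_all add: mult_le_mono1)

lemma convex_seq_lattice_paths: "convex_seq (\<lambda>i. lattice_paths (x + i * p) (y + i * q))"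
  unfolding convex_seq_def
proof (intro allI impI)
  fix i :: nat
  assume "1 \<le> i"
  then obtain j where i: "i = Suc j"
    by (cases i) auto
  \<comment> \<open>Consecutive differences are increments by the same vector \<open>(p, q)\<close>,
    based at consecutive points of the ray.\<close>
  have "int (lattice_paths (x + j * p + p) (y + j * q + q)) - int (lattice_paths (x + j * p) (y + j * q))
      \<le> int (lattice_paths (x + j * p + p + p) (y + j * q + q + q))
         - int (lattice_paths (x + j * p + p) (y + j * q + q))"
    by (rule lattice_paths_increment_mono) auto
  then show "2 * lattice_paths (x + i * p) (y + i * q)
      \<le> lattice_paths (x + (i - 1) * p) (y + (i - 1) * q)
         + lattice_paths (x + (i + 1) * p) (y + (i + 1) * q)"
    by (simp add: i algebra_simps)
qed

section \<open>Factorial quotients as rising factorials, and log-concavity\<close>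

lemma fact_add_pochhammer: "fact (n + m) = fact n * pochhammer (real (Suc n)) m"
  using pochhammer_product'[of "1 :: real" n m] by (simp add: pochhammer_fact add.commute)

text \<open>For fixed \<open>x\<close> the count at \<open>(x, w)\<close> is
  \<open>(w + 1) ... (w + x) / x!\<close>. Each linear factor runs through an arithmetic
  progression, which is log-concave, and log-concavity passes to products of nonnegative
  factors.\<close>

lemma log_concave_seq_lattice_paths: "log_concave_seq (\<lambda>i. lattice_paths x (y + i * q))"
  unfolding log_concave_seq_def
proof (intro allI impI)
  fix i :: nat
  assume "1 \<le> i"
  then obtain j where i: "i = Suc j"
    by (cases i) auto
  define z where "z = y + j * q"
  have eq: "real (lattice_paths x w) = pochhammer (real (Suc w)) x / fact x" for w
    using fact_add_pochhammer[of w x] by (simp add: real_lattice_paths add.commute field_simps)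
  have "pochhammer (real (Suc z)) x * pochhammer (real (Suc (z + 2 * q))) x
      \<le> (pochhammer (real (Suc (z + q))) x)\<^sup>2"
    unfolding pochhammer_prod power2_eq_square prod.distrib[symmetric]
    by (rule prod_mono) (auto simp: algebra_simps)
  then have "real (lattice_paths x z) * real (lattice_paths x (z + 2 * q))
      \<le> (real (lattice_paths x (z + q)))\<^sup>2"
    by (simp add: eq power_divide power2_eq_square divide_right_mono)
  then have "lattice_paths x z * lattice_paths x (z + 2 * q) \<le> (lattice_paths x (z + q))\<^sup>2"
    by (metis of_nat_le_iff of_nat_mult of_nat_power)
  then show "lattice_paths x (y + (i - 1) * q) * lattice_paths x (y + (i + 1) * q)
      \<le> (lattice_paths x (y + i * q))\<^sup>2"
    by (simp add: i z_def mult_2 add_ac)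
qed

text \<open>Each of the \<open>e\<close> factors of \<open>(c + 2 * e)! / (c + e)!\<close> exceeds
  its counterpart in \<open>(c + e)! / c!\<close> by \<open>e\<close>.\<close>

lemma fact_log_convex: "(fact (c + e))\<^sup>2 \<le> fact c * (fact (c + 2 * e) :: real)"
proof -
  have "pochhammer (real (Suc c)) e \<le> pochhammer (real (Suc (c + e))) e"
    unfolding pochhammer_prod by (rule prod_mono) auto
  then have "(fact c * fact (c + e)) * pochhammer (real (Suc c)) e
      \<le> (fact c * fact (c + e)) * pochhammer (real (Suc (c + e))) e"
    by (rule mult_left_mono) simp
  then show ?thesis
    using fact_add_pochhammer[of c e] fact_add_pochhammer[of "c + e" e]
    unfolding mult_2 add.assoc[symmetric] by (simp add: power2_eq_square mult_ac)
qed

text \<open>The first \<open>d\<close> factors are compared through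
  \<open>1 + d / (n + 1 + j) \<le> 1 + \<delta> / (a + 1 + j)\<close>. The other
  \<open>\<delta> - d\<close> factors occur only on the \<open>a\<close> side, where the shift by
  \<open>\<delta>\<close> enlarges them.\<close>

lemma pochhammer_quotient_antimono:
  assumes "a \<le> n" "d \<le> \<delta>"
  shows "pochhammer (real (Suc (n + d))) d * pochhammer (real (Suc a)) \<delta>
           \<le> pochhammer (real (Suc n)) d * pochhammer (real (Suc (a + \<delta>))) \<delta>"
proof -
  obtain e where \<delta>: "\<delta> = d + e"
    using assms(2) le_Suc_ex by blast
  have "pochhammer (real (Suc (n + d))) d * pochhammer (real (Suc a)) d
      \<le> pochhammer (real (Suc n)) d * pochhammer (real (Suc (a + \<delta>))) d"
    unfolding pochhammer_prod prod.distrib[symmetric]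
  proof (rule prod_mono, safe)
    fix j
    have "d * (a + 1 + j) \<le> \<delta> * (n + 1 + j)"
      using assms by (intro mult_le_mono) auto
    then have "(Suc (n + d) + j) * (Suc a + j) \<le> (Suc n + j) * (Suc (a + \<delta>) + j)"
      by (simp add: algebra_simps)
    then show "(real (Suc (n + d)) + real j) * (real (Suc a) + real j)
        \<le> (real (Suc n) + real j) * (real (Suc (a + \<delta>)) + real j)"
      by (metis of_nat_add of_nat_le_iff of_nat_mult)
  qed simp
  moreover have "pochhammer (real (Suc a) + real d) e \<le> pochhammer (real (Suc (a + \<delta>)) + real d) e"
    unfolding pochhammer_prod by (rule prod_mono) auto
  ultimately have "(pochhammer (real (Suc (n + d))) d * pochhammer (real (Suc a)) d)
        * pochhammer (real (Suc a) + real d) e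
      \<le> (pochhammer (real (Suc n)) d * pochhammer (real (Suc (a + \<delta>))) d)
        * pochhammer (real (Suc (a + \<delta>)) + real d) e"
    by (rule mult_mono) (simp_all add: pochhammer_nonneg)
  then show ?thesis
    unfolding \<delta> pochhammer_product' by (simp add: mult.assoc)
qed

text \<open>When the last coefficient is nonzero, the differences of upper and lower index are
  \<open>c + 2 * e\<close>, \<open>c + e\<close> and \<open>c\<close>. The inequality is then a
  product of two: log-convexity of the factorial handles these differences, and the comparison of
  rising factorials handles the remaining factorials.\<close>

lemma binomial_log_concave:
  assumes "d < \<delta>" "a \<le> n"
  shows "(n choose a) * ((n + 2 * d) choose (a + 2 * \<delta>)) \<le> ((n + d) choose (a + \<delta>))\<^sup>2"
proof (cases "a + 2 * \<delta> \<le> n + 2 * d")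
  case False
  then show ?thesis
    by (simp add: binomial_eq_0)
next
  case True
  define e where "e = \<delta> - d"
  define c where "c = n + 2 * d - (a + 2 * \<delta>)"
  have n: "n = a + c + 2 * e" and \<delta>: "\<delta> = d + e"
    using assms True by (simp_all add: e_def c_def)
  define p where "p = pochhammer (real (Suc n)) d"
  define p' where "p' = pochhammer (real (Suc (n + d))) d"
  define q where "q = pochhammer (real (Suc a)) \<delta>"
  define q' where "q' = pochhammer (real (Suc (a + \<delta>))) \<delta>"
  have pos: "p > 0" "p' > 0" "q > 0" "q' > 0"
    by (simp_all add: p_def p'_def q_def q'_def pochhammer_pos)
  have nd: "fact (n + d) = fact n * p" "fact (n + 2 * d) = fact n * p * p'"
    "fact (a + \<delta>) = fact a * q" "fact (a + 2 * \<delta>) = fact a * q * q'"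
    using fact_add_pochhammer[of n d] fact_add_pochhammer[of "n + d" d]
      fact_add_pochhammer[of a \<delta>] fact_add_pochhammer[of "a + \<delta>" \<delta>]
    by (simp_all add: p_def p'_def q_def q'_def mult_2 add.assoc)
  have C0: "real (n choose a) = fact n / (fact a * fact (c + 2 * e))"
    using assms by (simp add: binomial_fact n)
  have C1: "real ((n + d) choose (a + \<delta>)) = fact n * p / (fact a * q * fact (c + e))"
  proof -
    have "n + d - (a + \<delta>) = c + e" "a + \<delta> \<le> n + d"
      by (simp_all add: n \<delta>)
    then show ?thesis
      by (simp add: binomial_fact nd)
  qed
  have C2: "real ((n + 2 * d) choose (a + 2 * \<delta>)) = fact n * p * p' / (fact a * q * q' * fact c)"
  proof -
    have "n + 2 * d - (a + 2 * \<delta>) = c"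
      by (simp add: c_def)
    then show ?thesis
      using True by (simp add: binomial_fact nd)
  qed
  have "(p' * q) * (fact (c + e))\<^sup>2 \<le> (p * q') * (fact c * fact (c + 2 * e))"
  proof (rule mult_mono)
    show "p' * q \<le> p * q'"
      using pochhammer_quotient_antimono[of a n d \<delta>] assms
      unfolding p_def p'_def q_def q'_def by simp
  qed (use pos fact_log_convex in simp_all)
  then have le: "p' / (q' * fact c * fact (c + 2 * e)) \<le> p / (q * (fact (c + e))\<^sup>2)"
    using pos by (simp add: field_simps)
  have "real (n choose a) * real ((n + 2 * d) choose (a + 2 * \<delta>))
      = ((fact n)\<^sup>2 * p / ((fact a)\<^sup>2 * q)) * (p' / (q' * fact c * fact (c + 2 * e)))"
    unfolding C0 C2 by (simp add: power2_eq_square mult_ac)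
  also have "\<dots> \<le> ((fact n)\<^sup>2 * p / ((fact a)\<^sup>2 * q)) * (p / (q * (fact (c + e))\<^sup>2))"
    using pos by (intro mult_left_mono le) simp
  also have "\<dots> = (real ((n + d) choose (a + \<delta>)))\<^sup>2"
    unfolding C1 by (simp add: power2_eq_square mult_ac)
  finally show ?thesis
    by (metis of_nat_le_iff of_nat_mult of_nat_power)
qed

text \<open>After the first descent log-concavity propagates:
  \<open>a i * a (i + 2) \<le> (a (i + 1))^2 \<le> a i * a (i + 1)\<close>, and \<open>a i\<close>
  cancels unless it is 0. In that case \<open>zero\<close> keeps all later terms at 0.\<close>

lemma log_concave_imp_unimodal:
  fixes a :: "nat \<Rightarrow> nat"
  assumes lc: "log_concave_seq a"
    and zero: "\<And>i. a i = 0 \<Longrightarrow> a (i + 1) = 0"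
    and ex: "\<exists>i. a (i + 1) \<le> a i"
  shows "unimodal_seq a"
proof -
  define m where "m = (LEAST i. a (i + 1) \<le> a i)"
  have m: "a (m + 1) \<le> a m"
    unfolding m_def by (rule LeastI_ex[OF ex])
  have "a i \<le> a (i + 1)" if "i < m" for i
    using not_less_Least[OF that[unfolded m_def]] by simp
  moreover have "a (i + 1) \<le> a i" if "m \<le> i" for i
    using that
  proof (induction i rule: dec_induct)
    case base
    show ?case by (rule m)
  next
    case (step i)
    show ?case
    proof (cases "a i = 0")
      case True
      then show ?thesis
        using zero[of i] zero[of "Suc i"] by simp
    next
      case False
      have "a i * a (Suc i + 1) \<le> (a (Suc i))\<^sup>2"
        using lc[unfolded log_concave_seq_def, rule_format, of "Suc i"] by simp
      also have "\<dots> \<le> a i * a (Suc i)"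
        using step.IH by (simp add: power2_eq_square)
      finally show ?thesis
        using False by simp
    qed
  qed
  ultimately show ?thesis
    unfolding unimodal_seq_def by blast
qed

section \<open>Asymptotics of the logarithm of consecutive quotients\<close>

lemma sum_linear: "(\<Sum>j<m. (u + 1 + real j)) = m * u + real m * (real m + 1) / 2"
  by (induction m) (simp_all add: field_simps)

text \<open>Removing the leading term \<open>1 / t\<close> from one summand leaves
  \<open>- v / (t * (v + t * m))\<close> with \<open>v = u + 1 + j\<close>; times \<open>t^2\<close>
  this tends to \<open>- v / m\<close>. The limits are then summed over \<open>j\<close>.\<close>

lemma log_pochhammer_deriv_asymptotics:
  fixes u :: real
  assumes "m > 0"
  shows "((\<lambda>t. t\<^sup>2 * ((\<Sum>j<m. real m / (u + 1 + real j + t * real m)) - real m / t))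
           \<longlongrightarrow> - (u + (real m + 1) / 2)) at_top"
proof -
  have summand: "((\<lambda>t. t\<^sup>2 * (real m / (v + t * real m) - 1 / t)) \<longlongrightarrow> - (v / real m)) at_top" for v
  proof -
    have "((\<lambda>t :: real. 1 / t) \<longlongrightarrow> 0) at_top"
      by (simp add: divide_inverse tendsto_inverse_0_at_top filterlim_ident)
    then have "((\<lambda>t. - v / (v * (1 / t) + real m)) \<longlongrightarrow> - v / (v * 0 + real m)) at_top"
      using assms by (intro tendsto_intros) auto
    moreover have "eventually (\<lambda>t. - v / (v * (1 / t) + real m)
        = t\<^sup>2 * (real m / (v + t * real m) - 1 / t)) at_top"
      \<comment> \<open>Since \<open>m \<ge> 1\<close>, the bound \<open>t > \<bar>v\<bar>\<close>
        makes the denominator \<open>v + t * m\<close> positive.\<close>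
      using eventually_gt_at_top[of "max 0 (\<bar>v\<bar>)"]
    proof eventually_elim
      case (elim t)
      have "t * 1 \<le> t * real m"
        using assms elim by (intro mult_left_mono) auto
      then have pos: "v + t * real m > 0" "t > 0"
        using elim by linarith+
      then have "v * (1 / t) + real m = (v + t * real m) / t"
        by (simp add: field_simps)
      moreover have "real m / (v + t * real m) - 1 / t = - v / (t * (v + t * real m))"
        using pos by (subst diff_frac_eq) (auto simp: algebra_simps)
      ultimately show ?case
        using pos by (simp add: power2_eq_square)
    qed
    ultimately show ?thesis
      by (simp add: tendsto_cong)
  qed
  have "((\<lambda>t. \<Sum>j<m. t\<^sup>2 * (real m / (u + 1 + real j + t * real m) - 1 / t))
      \<longlongrightarrow> (\<Sum>j<m. - ((u + 1 + real j) / real m))) at_top"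
    by (intro tendsto_sum summand)
  moreover have "(\<Sum>j<m. - ((u + 1 + real j) / real m)) = - (u + (real m + 1) / 2)"
    unfolding sum_negf sum_divide_distrib[symmetric] sum_linear using assms by (simp add: field_simps)
  moreover have "(\<Sum>j<m. t\<^sup>2 * (real m / (u + 1 + real j + t * real m) - 1 / t))
      = t\<^sup>2 * ((\<Sum>j<m. real m / (u + 1 + real j + t * real m)) - real m / t)" for t
    by (simp add: sum_distrib_left[symmetric] sum_subtractf)
  ultimately show ?thesis
    by simp
qed

text \<open>At an integer \<open>t = i\<close> and natural \<open>u\<close> this is the logarithm of
  \<open>(u + (i + 1) * m)! / (u + i * m)!\<close>; the real argument \<open>t\<close> makes it
  differentiable.\<close>

definition log_pochhammer :: "real \<Rightarrow> nat \<Rightarrow> real \<Rightarrow> real" where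
  "log_pochhammer u m t = (\<Sum>j<m. ln (u + 1 + real j + t * real m))"

lemma log_pochhammer_deriv:
  assumes "u \<ge> 0" "t \<ge> 0"
  shows "(log_pochhammer u m has_real_derivative
           (\<Sum>j<m. real m / (u + 1 + real j + t * real m))) (at t)"
proof -
  have "0 < u + 1 + real j + t * real m" for j
    using assms by (simp add: add_nonneg_pos add_pos_nonneg)
  then show ?thesis
    unfolding log_pochhammer_def[abs_def]
    by (auto intro!: derivative_eq_intros)
qed

lemma exp_log_pochhammer:
  "exp (log_pochhammer (real u) m (real i)) = pochhammer (real (Suc (u + i * m))) m"
proof -
  have "exp (ln (real u + 1 + real j + real i * real m)) = real u + 1 + real j + real i * real m" for j
    by (rule exp_ln) (simp add: add_nonneg_pos add_pos_nonneg)
  then show ?thesis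
    by (simp add: log_pochhammer_def exp_sum pochhammer_prod atLeast0LessThan algebra_simps)
qed

lemma log_pochhammer_diff_eventually_mono:
  fixes u v :: real
  assumes "p > 0" "q > 0" "u \<ge> 0" "v \<ge> 0"
  defines "g \<equiv> \<lambda>t. log_pochhammer (u + v) (p + q) t - log_pochhammer u p t - log_pochhammer v q t"
  shows "\<exists>T. \<forall>s t. T \<le> s \<and> s \<le> t \<longrightarrow> g s \<le> g t"
proof -
  define g' where "g' = (\<lambda>t. (\<Sum>j<p + q. real (p + q) / (u + v + 1 + real j + t * real (p + q)))
     - (\<Sum>j<p. real p / (u + 1 + real j + t * real p)) - (\<Sum>j<q. real q / (v + 1 + real j + t * real q)))"
  have deriv: "(g has_real_derivative g' t) (at t)" if "t \<ge> 0" for t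
    unfolding g_def g'_def using that assms by (intro DERIV_diff log_pochhammer_deriv) auto
  have lim: "((\<lambda>t. t\<^sup>2 * ((\<Sum>j<p + q. real (p + q) / (u + v + 1 + real j + t * real (p + q))) - real (p + q) / t)
     - t\<^sup>2 * ((\<Sum>j<p. real p / (u + 1 + real j + t * real p)) - real p / t)
     - t\<^sup>2 * ((\<Sum>j<q. real q / (v + 1 + real j + t * real q)) - real q / t))
     \<longlongrightarrow> - (u + v + (real (p + q) + 1) / 2) - - (u + (real p + 1) / 2) - - (v + (real q + 1) / 2)) at_top"
    using assms(1,2) by (intro tendsto_diff log_pochhammer_deriv_asymptotics) auto
  have "- (u + v + (real (p + q) + 1) / 2) - - (u + (real p + 1) / 2) - - (v + (real q + 1) / 2) = 1 / 2"
    by (simp add: field_simps)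
  \<comment> \<open>The three subtracted terms \<open>(p + q) / t\<close>, \<open>p / t\<close> and
    \<open>q / t\<close> cancel, so only \<open>g'\<close> remains.\<close>
  with lim have "((\<lambda>t. t\<^sup>2 * g' t) \<longlongrightarrow> 1 / 2) at_top"
    by (simp add: g'_def algebra_simps add_divide_distrib)
  then have "eventually (\<lambda>t. t\<^sup>2 * g' t > 0) at_top"
    by (rule order_tendstoD(1)) simp
  then obtain T where T: "\<And>t. t \<ge> T \<Longrightarrow> t\<^sup>2 * g' t > 0"
    by (auto simp: eventually_at_top_linorder)
  \<comment> \<open>The derivative is available for nonnegative arguments, hence the bound
    \<open>max T 0\<close>.\<close>
  have "g s \<le> g t" if "max T 0 \<le> s" "s \<le> t" for s t
  proof (rule DERIV_nonneg_imp_nondecreasing[OF that(2)])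
    fix x
    assume "s \<le> x" "x \<le> t"
    then have "x \<ge> 0" "x\<^sup>2 * g' x > 0"
      using that T by auto
    then show "\<exists>y. (g has_real_derivative y) (at x) \<and> 0 \<le> y"
      using deriv by (meson less_eq_real_def zero_less_mult_pos zero_le_power2 zero_less_mult_iff not_less)
  qed
  then show ?thesis
    by blast
qed

text \<open>This turns log-convexity of the sequence into monotonicity of the exponent, a function
  of a real variable.\<close>

lemma lattice_paths_quotient:
  "real (lattice_paths (x + Suc i * p) (y + Suc i * q)) = real (lattice_paths (x + i * p) (y + i * q))
     * exp (log_pochhammer (real x + real y) (p + q) (real i)
         - log_pochhammer (real x) p (real i) - log_pochhammer (real y) q (real i))"
proof -
  define u where "u = x + i * p"
  define v where "v = y + i * q"
  have uv: "u + v = x + y + i * (p + q)"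
    by (simp add: u_def v_def algebra_simps)
  have "exp (log_pochhammer (real (x + y)) (p + q) (real i)
         - log_pochhammer (real x) p (real i) - log_pochhammer (real y) q (real i))
      = pochhammer (real (Suc (u + v))) (p + q)
          / (pochhammer (real (Suc u)) p * pochhammer (real (Suc v)) q)"
    by (simp only: exp_diff exp_log_pochhammer uv) (simp add: u_def v_def)
  moreover have "real (lattice_paths (u + p) (v + q))
      = (fact (u + v) * pochhammer (real (Suc (u + v))) (p + q))
          / (fact u * pochhammer (real (Suc u)) p * (fact v * pochhammer (real (Suc v)) q))"
    unfolding fact_add_pochhammer[symmetric] by (simp add: real_lattice_paths add_ac)
  ultimately have "real (lattice_paths (u + p) (v + q)) = real (lattice_paths u v)
     * exp (log_pochhammer (real (x + y)) (p + q) (real i)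
         - log_pochhammer (real x) p (real i) - log_pochhammer (real y) q (real i))"
    by (simp only: real_lattice_paths[of u v]) simp
  then show ?thesis
    by (simp add: u_def v_def add_ac)
qed

lemma asymp_log_convex_seq_lattice_paths:
  assumes "p > 0" "q > 0"
  shows "asymp_log_convex_seq (\<lambda>i. lattice_paths (x + i * p) (y + i * q))"
proof -
  define g where "g = (\<lambda>t. log_pochhammer (real x + real y) (p + q) t
     - log_pochhammer (real x) p t - log_pochhammer (real y) q t)"
  define a where "a = (\<lambda>i. lattice_paths (x + i * p) (y + i * q))"
  have a_Suc: "real (a (Suc i)) = real (a i) * exp (g (real i))" for i
    unfolding a_def g_def by (rule lattice_paths_quotient)
  obtain T where T: "\<And>s t. T \<le> s \<Longrightarrow> s \<le> t \<Longrightarrow> g s \<le> g t"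
    using log_pochhammer_diff_eventually_mono[OF assms, of "real x" "real y"] unfolding g_def by auto
  obtain m where m: "T \<le> real m"
    using real_arch_simple by blast
  have "log_convex_seq (\<lambda>i. a (m + i))"
    unfolding log_convex_seq_def
  proof (intro allI impI)
    fix i :: nat
    assume "1 \<le> i"
    then obtain j where i: "i = Suc j"
      by (cases i) auto
    have "exp (g (real (m + j))) \<le> exp (g (real (Suc (m + j))))"
      using m by (simp only: exp_le_cancel_iff) (rule T, simp_all)
    \<comment> \<open>Multiplying by both terms lets each exponential be absorbed as a quotient of
      consecutive terms.\<close>
    then have "(real (a (m + j)) * real (a (Suc (m + j)))) * exp (g (real (m + j)))
        \<le> (real (a (m + j)) * real (a (Suc (m + j)))) * exp (g (real (Suc (m + j))))"
      by (rule mult_left_mono) simp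
    then have "(real (a (Suc (m + j))))\<^sup>2 \<le> real (a (m + j)) * real (a (Suc (Suc (m + j))))"
      by (simp add: a_Suc[of "Suc (m + j)"] power2_eq_square)
        (simp add: a_Suc[of "m + j"] mult_ac)
    then have "(a (Suc (m + j)))\<^sup>2 \<le> a (m + j) * a (Suc (Suc (m + j)))"
      by (metis of_nat_le_iff of_nat_mult of_nat_power)
    then show "(a (m + i))\<^sup>2 \<le> a (m + (i - 1)) * a (m + (i + 1))"
      by (simp add: i)
  qed
  then show ?thesis
    unfolding asymp_log_convex_seq_def a_def by blast
qed

section \<open>The case \<open>d < \<delta>\<close>: vanishing terms and unimodality\<close>

lemma log_concave_seq_binomial:
  assumes "k \<le> n" "d < \<delta>"
  shows "log_concave_seq (\<lambda>i. (n + i * d) choose (k + i * \<delta>))"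
  unfolding log_concave_seq_def
proof (intro allI impI)
  fix i :: nat
  assume "1 \<le> i"
  then obtain j where i: "i = Suc j"
    by (cases i) auto
  have "((n + j * d) choose (k + j * \<delta>)) * ((n + j * d + 2 * d) choose (k + j * \<delta> + 2 * \<delta>))
      \<le> ((n + j * d + d) choose (k + j * \<delta> + \<delta>))\<^sup>2"
  \<comment> \<open>Once the lower index exceeds the upper one, the left-hand product is 0.\<close>
  proof (cases "k + j * \<delta> \<le> n + j * d")
    case True
    then show ?thesis
      by (rule binomial_log_concave[OF assms(2)])
  qed (simp add: binomial_eq_0)
  then show "((n + (i - 1) * d) choose (k + (i - 1) * \<delta>)) * ((n + (i + 1) * d) choose (k + (i + 1) * \<delta>))
      \<le> ((n + i * d) choose (k + i * \<delta>))\<^sup>2"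
    by (simp add: i mult_2 add_ac)
qed

lemma unimodal_seq_binomial:
  assumes "k \<le> n" "d < \<delta>"
  shows "unimodal_seq (\<lambda>i. (n + i * d) choose (k + i * \<delta>))"
proof (rule log_concave_imp_unimodal[OF log_concave_seq_binomial[OF assms]])
  show "(n + (i + 1) * d) choose (k + (i + 1) * \<delta>) = 0"
    if "(n + i * d) choose (k + i * \<delta>) = 0" for i
    using that assms(2) by (simp add: binomial_eq_0_iff)
  \<comment> \<open>The lower index gains at least 1 on the upper one at each step, so the term at
    index \<open>n + 1\<close> is 0, which gives a descent at index \<open>n\<close>.\<close>
  have "Suc n * d + Suc n \<le> Suc n * \<delta>"
    using mult_le_mono2[of "Suc d" \<delta> "Suc n"] assms(2) by simp
  then have "(n + (n + 1) * d) choose (k + (n + 1) * \<delta>) = 0"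
    by (intro binomial_eq_0) simp
  then show "\<exists>i. (n + (i + 1) * d) choose (k + (i + 1) * \<delta>) \<le> (n + i * d) choose (k + i * \<delta>)"
    by (metis le0)
qed

theorem theorem1p2:
  fixes n\<^sub>0 k\<^sub>0 d \<delta> :: nat and C :: "nat \<Rightarrow> nat"
  assumes "n\<^sub>0 \<ge> k\<^sub>0"
    and "\<And>i. C i = (n\<^sub>0 + i * d) choose (k\<^sub>0 + i * \<delta>)"
  shows "((d = \<delta> \<and> \<delta> > 0) \<or> \<delta> = 0 \<longrightarrow> incseq C \<and> convex_seq C \<and> log_concave_seq C) \<and>
         (d < \<delta> \<longrightarrow> log_concave_seq C \<and> unimodal_seq C) \<and>
         (d > \<delta> \<and> \<delta> > 0 \<longrightarrow> incseq C \<and> convex_seq C \<and> asymp_log_convex_seq C)"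
proof -
  \<comment> \<open>The ray starts at the lattice point \<open>(k\<^sub>0, b)\<close>.\<close>
  define b where "b = n\<^sub>0 - k\<^sub>0"
  have C: "C = (\<lambda>i. (n\<^sub>0 + i * d) choose (k\<^sub>0 + i * \<delta>))"
    using assms(2) by blast
  have ray: "C = (\<lambda>i. lattice_paths (k\<^sub>0 + i * \<delta>) (b + i * (d - \<delta>)))" if "\<delta> \<le> d"
  proof
    fix i
    obtain e where "d = \<delta> + e"
      using \<open>\<delta> \<le> d\<close> le_Suc_ex by blast
    then have "k\<^sub>0 + i * \<delta> + (b + i * (d - \<delta>)) = n\<^sub>0 + i * d"
      using assms(1) by (simp add: b_def algebra_simps)
    then show "C i = lattice_paths (k\<^sub>0 + i * \<delta>) (b + i * (d - \<delta>))"
      by (simp add: C lattice_paths_def)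
  qed
  have inc: "incseq C \<and> convex_seq C" if "\<delta> \<le> d"
    unfolding ray[OF that] using incseq_lattice_paths convex_seq_lattice_paths by blast
  \<comment> \<open>Here the second coordinate stays at \<open>b\<close>; symmetry makes it the
    fixed first coordinate of the lemma.\<close>
  have "log_concave_seq C" if "d = \<delta>"
    using log_concave_seq_lattice_paths[of b k\<^sub>0 \<delta>] ray that by (simp add: lattice_paths_commute)
  moreover have "log_concave_seq C" if "\<delta> = 0"
    using log_concave_seq_lattice_paths[of k\<^sub>0 b d] ray that by simp
  moreover have "log_concave_seq C \<and> unimodal_seq C" if "d < \<delta>"
    unfolding C using log_concave_seq_binomial unimodal_seq_binomial assms(1) that by blast
  moreover have "asymp_log_convex_seq C" if "\<delta> < d" "0 < \<delta>"
    unfolding ray[OF less_imp_le[OF that(1)]]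
    using that by (intro asymp_log_convex_seq_lattice_paths) auto
  ultimately show ?thesis
    using inc by auto
qed

end
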